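(* For every total recursive function $\phi : \mathbb{N} \to \mathbb{N}$, there exists a $\phi$-impredictable $\Sigma^0_1$ set $A \subset \mathbb{N}$.
   Context: Let $\mathcal{T}$ be the set of total recursive functions and $\mathcal{P}$ the set of all partial recursive functions (Turing machines). Write $\chi(\cdot){\downarrow}$ if the machine $\chi$ halts on the given input. $A \upharpoonright m$ denotes the word in $\{0,1\}^m$ consisting of the first $m$ bits of the characteristic sequence of $A$. For a function $\phi : \mathbb{N}\to\mathbb{N}$, a set $A \subset \mathbb{N}$ is $\phi$-impredictable if there exists $\psi \in \mathcal{T}$ such that for all $\chi \in \mathcal{P}$ there are infinitely many $p \in \mathbb{N}$ with $$\psi(p) \in A \iff \chi(p, A \upharpoonright \phi(p)){\downarrow}.$$ *)

theory Defs
  imports Main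
begin

text \<open>
  Partial recursive functions are represented by Kleene's schemes: zero, successor, projections,
  composition, primitive recursion and unbounded minimisation.
\<close>

datatype recf =
    Zero
  | Succ
  | Proj nat
  | Comp recf "recf list"
  | PrimRec recf recf
  | Mu recf

text \<open>
  A term does not carry its arity. In \<open>PrimRec f g\<close> the recursion variable is the first argument,
  and \<open>g\<close> receives the predecessor, the previous value and then the parameters.
\<close>

fun has_arity :: "recf \<Rightarrow> nat \<Rightarrow> bool" where
  "has_arity Zero k \<longleftrightarrow> True"
| "has_arity Succ k \<longleftrightarrow> k = 1"
| "has_arity (Proj i) k \<longleftrightarrow> i < k"
| "has_arity (Comp f gs) k \<longleftrightarrow> has_arity f (length gs) \<and> (\<forall>g\<in>set gs. has_arity g k)"
| "has_arity (PrimRec f g) k \<longleftrightarrow> 0 < k \<and> has_arity f (k - 1) \<and> has_arity g (k + 1)"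
| "has_arity (Mu f) k \<longleftrightarrow> has_arity f (k + 1)"

text \<open>
  The value \<open>None\<close> means divergence. Composition is strict in all its arguments, and \<open>Mu f\<close>
  converges only if \<open>f\<close> converges at all candidates below the first zero. The result is only
  meaningful on argument lists whose length is an arity of the term.
\<close>

fun eval :: "recf \<Rightarrow> nat list \<Rightarrow> nat option" where
  "eval Zero xs = Some 0"
| "eval Succ xs = Some (Suc (hd xs))"
| "eval (Proj i) xs = Some (xs ! i)"
| "eval (Comp f gs) xs =
    (if \<forall>g\<in>set gs. eval g xs \<noteq> None then eval f (map (\<lambda>g. the (eval g xs)) gs) else None)"
| "eval (PrimRec f g) xs =
    rec_nat (eval f (tl xs)) (\<lambda>y r. Option.bind r (\<lambda>v. eval g (y # v # tl xs))) (hd xs)"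
| "eval (Mu f) xs =
    (if \<exists>z. eval f (z # xs) = Some 0 \<and> (\<forall>y<z. eval f (y # xs) \<noteq> None)
     then Some (LEAST z. eval f (z # xs) = Some 0) else None)"

definition partial_recursive :: "nat \<Rightarrow> (nat list \<Rightarrow> nat option) \<Rightarrow> bool" where
  "partial_recursive k F \<longleftrightarrow>
    (\<exists>f. has_arity f k \<and> (\<forall>xs. length xs = k \<longrightarrow> F xs = eval f xs))"

definition total_recursive :: "(nat \<Rightarrow> nat) \<Rightarrow> bool" where
  "total_recursive \<phi> \<longleftrightarrow> partial_recursive 1 (\<lambda>xs. Some (\<phi> (xs ! 0)))"

definition recursive_relation :: "(nat \<Rightarrow> nat \<Rightarrow> bool) \<Rightarrow> bool" where
  "recursive_relation R \<longleftrightarrow> partial_recursive 2 (\<lambda>xs. Some (of_bool (R (xs ! 0) (xs ! 1))))"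

definition Sigma01 :: "nat set \<Rightarrow> bool" where
  "Sigma01 A \<longleftrightarrow> (\<exists>R. recursive_relation R \<and> A = {x. \<exists>y. R x y})"

text \<open>
  Binary words are given to recursive functions through bijective base-2 numeration, with digits
  1 and 2 for the bits 0 and 1 and the first bit least significant.
\<close>

fun word_code :: "bool list \<Rightarrow> nat" where
  "word_code [] = 0"
| "word_code (b # w) = 2 * word_code w + (if b then 2 else 1)"

lemma bij_word_code: "bij word_code"
proof (rule bijI)
  have "word_code v = word_code w \<Longrightarrow> v = w" for v w
  proof (induction v arbitrary: w)
    case Nil
    then show ?case by (cases w) (auto split: if_splits)
  next
    case (Cons b v)
    then obtain c w' where w: "w = c # w'"
      by (cases w) (auto split: if_splits)
    with Cons.prems have "b = c \<and> word_code v = word_code w'"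
      by (cases b; cases c; simp) presburger+
    with Cons.IH w show ?case by simp
  qed
  then show "inj word_code" by (rule injI)
next
  have "\<exists>w. word_code w = n" for n
  proof (induction n rule: less_induct)
    case (less n)
    show ?case
    proof (cases "n = 0")
      case True
      then show ?thesis by (intro exI[of _ "[]"]) simp
    next
      case False
      then have "(n - 1) div 2 < n" by simp
      with less obtain w where "word_code w = (n - 1) div 2" by blast
      with False have "word_code (even n # w) = n"
        by (cases "even n") (auto elim!: evenE oddE)
      then show ?thesis by blast
    qed
  qed
  then show "surj word_code" by (metis surjI)
qed

definition partial_recursive_on_words :: "(nat \<Rightarrow> bool list \<Rightarrow> nat option) \<Rightarrow> bool" where
  "partial_recursive_on_words \<chi> \<longleftrightarrow>
    (\<exists>F. partial_recursive 2 F \<and> (\<forall>p w. \<chi> p w = F [p, word_code w]))"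

definition restrict_word :: "nat set \<Rightarrow> nat \<Rightarrow> bool list" where
  "restrict_word A m = map (\<lambda>i. i \<in> A) [0..<m]"

definition impredictable :: "(nat \<Rightarrow> nat) \<Rightarrow> nat set \<Rightarrow> bool" where
  "impredictable \<phi> A \<longleftrightarrow>
    (\<exists>\<psi>. total_recursive \<psi> \<and>
      (\<forall>\<chi>. partial_recursive_on_words \<chi> \<longrightarrow>
        infinite {p. \<psi> p \<in> A \<longleftrightarrow> \<chi> p (restrict_word A (\<phi> p)) \<noteq> None}))"

end

theory Submission
  imports Defs "HOL-Library.Nat_Bijection"
begin

text \<open>
  Positions \<open>p\<close> are arranged in levels, each belonging to one program, with every program owning
  infinitely many levels. All places \<open>\<psi> p\<close> of a level lie beyond the values of \<open>\<phi>\<close> on that level,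
  so the words \<open>A \<upharpoonright> \<phi> p\<close> there depend only on the finitely many decisions made at earlier levels.
  The level contains one position for each conceivable outcome of these decisions, and this position
  runs its program on the word given by that outcome instead of the true word; \<open>\<psi> p\<close> enters \<open>A\<close> if
  the program halts. Hence \<open>A\<close> is recursively enumerable, and on each level the position with the
  true outcome satisfies the required equivalence.
\<close>

section \<open>Total recursive functions\<close>

text \<open>Only total functions are tracked, so closure rules carry no divergence conditions;
  partiality is confined to the simulated machine.\<close>

definition computable :: "nat \<Rightarrow> (nat list \<Rightarrow> nat) \<Rightarrow> bool" where
  "computable k F \<longleftrightarrow> partial_recursive k (\<lambda>xs. Some (F xs))"

named_theorems computable_intros

lemma computable_cong:
  assumes "computable k F" and "\<And>xs. length xs = k \<Longrightarrow> F xs = G xs"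
  shows "computable k G"
  using assms unfolding computable_def partial_recursive_def by metis

lemma computable_comp:
  assumes F: "computable (length Gs) F" and Gs: "\<And>G. G \<in> set Gs \<Longrightarrow> computable k G"
  shows "computable k (\<lambda>xs. F (map (\<lambda>G. G xs) Gs))"
proof -
  from F obtain f where f: "has_arity f (length Gs)"
    "\<And>ys. length ys = length Gs \<Longrightarrow> eval f ys = Some (F ys)"
    unfolding computable_def partial_recursive_def by metis
  from Gs have "\<forall>G\<in>set Gs. \<exists>g. has_arity g k \<and> (\<forall>xs. length xs = k \<longrightarrow> eval g xs = Some (G xs))"
    unfolding computable_def partial_recursive_def by metis
  then obtain t where t: "\<And>G. G \<in> set Gs \<Longrightarrow> has_arity (t G) k"
    "\<And>G xs. G \<in> set Gs \<Longrightarrow> length xs = k \<Longrightarrow> eval (t G) xs = Some (G xs)"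
    by metis
  have "eval (Comp f (map t Gs)) xs = Some (F (map (\<lambda>G. G xs) Gs))" if "length xs = k" for xs
    using that f(2) t(2) by (simp add: comp_def cong: map_cong)
  moreover have "has_arity (Comp f (map t Gs)) k"
    using f(1) t(1) by simp
  ultimately show ?thesis
    unfolding computable_def partial_recursive_def by metis
qed

lemma computable_comp1:
  assumes "computable 1 (\<lambda>xs. f (xs ! 0))" "computable k a"
  shows "computable k (\<lambda>xs. f (a xs))"
  using computable_comp[of "[a]" "\<lambda>xs. f (xs ! 0)" k] assms by simp

lemma computable_comp2:
  assumes "computable 2 (\<lambda>xs. f (xs ! 0) (xs ! 1))" "computable k a" "computable k b"
  shows "computable k (\<lambda>xs. f (a xs) (b xs))"
  using computable_comp[of "[a, b]" "\<lambda>xs. f (xs ! 0) (xs ! 1)" k] assms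
  by (auto simp: numeral_2_eq_2)

lemma computable_nth [computable_intros]: "i < k \<Longrightarrow> computable k (\<lambda>xs. xs ! i)"
  unfolding computable_def partial_recursive_def by (intro exI[of _ "Proj i"]) simp

lemma computable_drop_nth [computable_intros]: "m + i < k \<Longrightarrow> computable k (\<lambda>xs. drop m xs ! i)"
  by (rule computable_cong[OF computable_nth[of "m + i"]]) auto

lemma computable_Suc [computable_intros]:
  assumes "computable k a"
  shows "computable k (\<lambda>xs. Suc (a xs))"
proof (rule computable_comp1[OF _ assms])
  have "eval Succ xs = Some (Suc (xs ! 0))" if "length xs = 1" for xs
    using that by (cases xs) auto
  then show "computable 1 (\<lambda>xs. Suc (xs ! 0))"
    unfolding computable_def partial_recursive_def by (intro exI[of _ Succ]) simp
qed

lemma computable_const [computable_intros]: "computable k (\<lambda>xs. c)"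
proof (induction c)
  case 0
  show ?case
    unfolding computable_def partial_recursive_def by (intro exI[of _ Zero]) simp
next
  case (Suc c)
  then show ?case by (rule computable_Suc)
qed

lemma computable_drop:
  assumes "computable k F"
  shows "computable (k + m) (\<lambda>ys. F (drop m ys))"
proof (rule computable_cong)
  show "computable (k + m)
    (\<lambda>ys. F (map (\<lambda>G. G ys) (map (\<lambda>i ys. ys ! (m + i)) [0..<k])))"
    by (rule computable_comp) (use assms in \<open>auto intro: computable_nth\<close>)
  show "F (map (\<lambda>G. G ys) (map (\<lambda>i ys. ys ! (m + i)) [0..<k])) = F (drop m ys)"
    if "length ys = k + m" for ys :: "nat list"
    using that by (intro arg_cong[of _ _ F] nth_equalityI) auto
qed

text \<open>\<open>PrimRec\<close> recurses on the first of \<open>Suc k\<close> arguments.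
  Composing with \<open>m\<close> and the \<open>k\<close> projections turns this into recursion to
  a depth computed from the parameters.\<close>

lemma computable_rec [computable_intros]:
  assumes a: "computable k a"
    and g: "computable (k + 2) (\<lambda>ys. g (ys ! 0) (ys ! 1) (drop 2 ys))"
    and m: "computable k m"
  shows "computable k (\<lambda>xs. rec_nat (a xs) (\<lambda>n r. g n r xs) (m xs))"
proof -
  let ?P = "\<lambda>ys. rec_nat (a (tl ys)) (\<lambda>n r. g n r (tl ys)) (hd ys)"
  from a obtain fa where fa: "has_arity fa k" "\<And>xs. length xs = k \<Longrightarrow> eval fa xs = Some (a xs)"
    unfolding computable_def partial_recursive_def by metis
  from g obtain fg where fg: "has_arity fg (k + 2)"
    "\<And>ys. length ys = k + 2 \<Longrightarrow> eval fg ys = Some (g (ys ! 0) (ys ! 1) (drop 2 ys))"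
    unfolding computable_def partial_recursive_def by metis
  have "eval (PrimRec fa fg) ys = Some (?P ys)" if "length ys = Suc k" for ys
  proof -
    have "rec_nat (eval fa (tl ys)) (\<lambda>y r. Option.bind r (\<lambda>v. eval fg (y # v # tl ys))) n =
      Some (rec_nat (a (tl ys)) (\<lambda>n r. g n r (tl ys)) n)" for n
      using that fa(2) fg(2) by (induction n) auto
    then show ?thesis by simp
  qed
  moreover have "has_arity (PrimRec fa fg) (Suc k)"
    using fa(1) fg(1) by (simp add: numeral_2_eq_2)
  ultimately have P: "computable (Suc k) ?P"
    unfolding computable_def partial_recursive_def by metis
  show ?thesis
  proof (rule computable_cong)
    show "computable k (\<lambda>xs. ?P (map (\<lambda>G. G xs) (m # map (\<lambda>i xs. xs ! i) [0..<k])))"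
      by (rule computable_comp) (use P m in \<open>auto intro: computable_nth\<close>)
    fix xs :: "nat list"
    assume "length xs = k"
    then have "map (\<lambda>G. G xs) (map (\<lambda>i xs. xs ! i) [0..<k]) = xs"
      by (intro nth_equalityI) auto
    then show "?P (map (\<lambda>G. G xs) (m # map (\<lambda>i xs. xs ! i) [0..<k])) =
      rec_nat (a xs) (\<lambda>n r. g n r xs) (m xs)" by simp
  qed
qed

section \<open>Arithmetic and decidable predicates\<close>

lemma computable_add [computable_intros]:
  assumes "computable k a" "computable k b"
  shows "computable k (\<lambda>xs. a xs + b xs)"
proof -
  have "rec_nat x (\<lambda>_ r. Suc r) y = x + y" for x y by (induction y) auto
  moreover have "computable 2 (\<lambda>xs. rec_nat (xs ! 0) (\<lambda>_ r. Suc r) (xs ! 1))"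
    by (intro computable_intros) auto
  ultimately show ?thesis by (auto intro: computable_comp2 assms)
qed

lemma computable_pred:
  assumes "computable k a"
  shows "computable k (\<lambda>xs. a xs - 1)"
proof -
  have "rec_nat 0 (\<lambda>n _. n) x = x - 1" for x :: nat by (cases x) auto
  moreover have "computable 1 (\<lambda>xs. rec_nat 0 (\<lambda>n _. n) (xs ! 0))"
    by (intro computable_intros) auto
  ultimately show ?thesis using computable_comp1[OF _ assms, of "\<lambda>x. x - 1"] by auto
qed

lemma computable_diff [computable_intros]:
  assumes "computable k a" "computable k b"
  shows "computable k (\<lambda>xs. a xs - b xs)"
proof -
  have "rec_nat x (\<lambda>_ r. r - 1) y = x - y" for x y :: nat by (induction y) auto
  moreover have "computable 2 (\<lambda>xs. rec_nat (xs ! 0) (\<lambda>_ r. r - 1) (xs ! 1))"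
    by (intro computable_intros computable_pred) auto
  ultimately show ?thesis by (auto intro: computable_comp2 assms)
qed

lemma computable_mult [computable_intros]:
  assumes "computable k a" "computable k b"
  shows "computable k (\<lambda>xs. a xs * b xs)"
proof -
  have "rec_nat 0 (\<lambda>_ r. r + x) y = x * y" for x y :: nat by (induction y) auto
  moreover have "computable 2 (\<lambda>xs. rec_nat 0 (\<lambda>_ r. r + xs ! 0) (xs ! 1))"
    by (intro computable_intros) auto
  ultimately show ?thesis by (auto intro: computable_comp2 assms)
qed

lemma computable_power2 [computable_intros]:
  assumes "computable k a"
  shows "computable k (\<lambda>xs. 2 ^ a xs)"
proof -
  have "rec_nat 1 (\<lambda>_ r. r + r) x = (2 :: nat) ^ x" for x by (induction x) auto
  moreover have "computable 1 (\<lambda>xs. rec_nat 1 (\<lambda>_ r. r + r) (xs ! 0))"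
    by (intro computable_intros) auto
  ultimately show ?thesis using computable_comp1[OF _ assms, of "\<lambda>x. 2 ^ x"] by auto
qed

lemma computable_eq [computable_intros]:
  assumes "computable k a" "computable k b"
  shows "computable k (\<lambda>xs. of_bool (a xs = b xs))"
proof (rule computable_cong)
  show "computable k (\<lambda>xs. 1 - ((a xs - b xs) + (b xs - a xs)))"
    by (intro computable_intros assms)
qed auto

lemma computable_less [computable_intros]:
  assumes "computable k a" "computable k b"
  shows "computable k (\<lambda>xs. of_bool (a xs < b xs))"
proof (rule computable_cong)
  show "computable k (\<lambda>xs. 1 - (1 - (b xs - a xs)))"
    by (intro computable_intros assms)
qed auto

lemma computable_conj [computable_intros]:
  assumes "computable k (\<lambda>xs. of_bool (P xs))" "computable k (\<lambda>xs. of_bool (Q xs))"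
  shows "computable k (\<lambda>xs. of_bool (P xs \<and> Q xs))"
proof (rule computable_cong)
  show "computable k (\<lambda>xs. of_bool (P xs) * of_bool (Q xs))"
    by (intro computable_intros assms)
qed auto

lemma computable_if [computable_intros]:
  assumes P: "computable k (\<lambda>xs. of_bool (P xs))" and a: "computable k a" and b: "computable k b"
  shows "computable k (\<lambda>xs. if P xs then a xs else b xs)"
proof (rule computable_cong)
  \<comment> \<open>The branch is selected by a recursion of depth 0 or 1.\<close>
  show "computable k (\<lambda>xs. rec_nat (b xs) (\<lambda>_ _. a xs) (of_bool (P xs)))"
    by (intro computable_rec P b computable_drop[OF a])
qed auto

lemma computable_mod [computable_intros]:
  assumes "computable k a" "computable k b"
  shows "computable k (\<lambda>xs. a xs mod b xs)"
proof -
  \<comment> \<open>For \<open>y = 0\<close> the counter is never reset and ends at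
    \<open>x\<close>, in agreement with \<open>x mod 0 = x\<close>.\<close>
  have "rec_nat 0 (\<lambda>_ r. if Suc r = y then 0 else Suc r) x = x mod y" for x y
    by (induction x) (auto simp: mod_Suc)
  moreover have "computable 2
    (\<lambda>xs. rec_nat 0 (\<lambda>_ r. if Suc r = xs ! 1 then 0 else Suc r) (xs ! 0))"
    by (intro computable_intros) auto
  ultimately show ?thesis by (auto intro: computable_comp2 assms)
qed

lemma computable_triangle [computable_intros]:
  assumes "computable k a"
  shows "computable k (\<lambda>xs. triangle (a xs))"
proof -
  have "rec_nat 0 (\<lambda>n r. r + Suc n) x = triangle x" for x by (induction x) auto
  moreover have "computable 1 (\<lambda>xs. rec_nat 0 (\<lambda>n r. r + Suc n) (xs ! 0))"
    by (intro computable_intros) auto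
  ultimately show ?thesis using computable_comp1[OF _ assms, of triangle] by auto
qed

section \<open>Cantor pairing and its projections\<close>

abbreviation pr :: "nat \<Rightarrow> nat \<Rightarrow> nat" where "pr a b \<equiv> prod_encode (a, b)"
abbreviation p1 :: "nat \<Rightarrow> nat" where "p1 x \<equiv> fst (prod_decode x)"
abbreviation p2 :: "nat \<Rightarrow> nat" where "p2 x \<equiv> snd (prod_decode x)"

text \<open>The index of the Cantor diagonal containing the argument: the largest \<open>r\<close>
  whose triangle number does not exceed it.\<close>

definition troot :: "nat \<Rightarrow> nat" where
  "troot = rec_nat 0 (\<lambda>n r. if triangle (Suc r) = Suc n then Suc r else r)"

lemma computable_troot [computable_intros]:
  assumes "computable k a"
  shows "computable k (\<lambda>xs. troot (a xs))"
  unfolding troot_def by (intro computable_intros assms) auto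

lemma troot_bounds: "triangle (troot x) \<le> x \<and> x < triangle (Suc (troot x))"
  by (induction x) (auto simp: troot_def)

text \<open>\<open>prod_encode (m, n)\<close> is \<open>triangle (m + n) + m\<close>, and the excess
  of \<open>x\<close> over \<open>triangle (troot x)\<close> is at most \<open>troot x\<close>. This
  closed form makes the projections computable.\<close>

lemma prod_decode_troot:
  "prod_decode x = (x - triangle (troot x), troot x - (x - triangle (troot x)))"
proof -
  have "pr (x - triangle (troot x)) (troot x - (x - triangle (troot x))) = x"
    using troot_bounds[of x] by (simp add: prod_encode_def)
  then show ?thesis by (metis prod_encode_inverse)
qed

lemma computable_pr [computable_intros]:
  assumes "computable k a" "computable k b"
  shows "computable k (\<lambda>xs. pr (a xs) (b xs))"
  unfolding prod_encode_def prod.case by (intro computable_intros assms)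

lemma computable_p1 [computable_intros]:
  assumes "computable k a"
  shows "computable k (\<lambda>xs. p1 (a xs))"
  unfolding prod_decode_troot fst_conv by (intro computable_intros assms)

lemma computable_p2 [computable_intros]:
  assumes "computable k a"
  shows "computable k (\<lambda>xs. p2 (a xs))"
  unfolding prod_decode_troot snd_conv by (intro computable_intros assms)

section \<open>A universal machine\<close>

text \<open>Instructions on a memory stack \<open>pr t r\<close> with top \<open>t\<close>: 0 to 3
  replace \<open>t\<close> by zero, its incremented head, its head, its tail; 4 duplicates, 5 swaps,
  6 conses the second entry onto the top. Codes 7 to 10 enter, prepare, close and leave an iteration
  of \<open>PrimRec\<close>; 11 to 13 start, advance and finish the search of
  \<open>Mu\<close>.\<close>

definition basic_op :: "nat \<Rightarrow> nat \<Rightarrow> nat" where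
  "basic_op a v = (let t = p1 v; r = p2 v in
    if a = 0 then pr 0 r
    else if a = 1 then pr (Suc (p1 t)) r
    else if a = 2 then pr (p1 t) r
    else if a = 3 then pr (p2 t) r
    else if a = 4 then pr t (pr t r)
    else if a = 5 then pr (p1 r) (pr t (p2 r))
    else if a = 6 then pr (pr (p1 r) t) (p2 r)
    else if a = 7 then pr (p1 (p1 r)) (pr (pr 0 (pr t (p2 (p1 r)))) (p2 r))
    else if a = 8 then pr (p1 r) (pr (t - 1) (pr (pr (Suc (p1 (p1 r))) (p2 (p2 (p1 r)))) (p2 r)))
    else if a = 9 then
      pr (p1 r) (pr (pr (p1 (p1 (p2 r))) (pr t (p2 (p1 (p2 r))))) (p2 (p2 r)))
    else if a = 10 then pr (p1 (p2 (p1 r))) (p2 r)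
    else if a = 11 then pr 1 (pr (pr 0 t) r)
    else if a = 12 then pr (p1 r) (pr (pr (Suc (p1 (p1 r))) (p2 (p1 r))) (p2 r))
    else pr (p1 (p1 r) - 1) (p2 r))"

definition opc :: "nat \<Rightarrow> nat" where "opc a = pr 0 a"
definition seq :: "nat \<Rightarrow> nat \<Rightarrow> nat" where "seq c d = pr 1 (pr c d)"
definition while :: "nat \<Rightarrow> nat" where "while c = pr 2 c"
definition push :: "nat \<Rightarrow> nat \<Rightarrow> nat" where "push c k = Suc (pr c k)"

text \<open>
  A configuration \<open>pr k v\<close> consists of a stack \<open>k\<close> of programs, with \<open>0\<close> for the empty stack, and
  the memory \<open>v\<close>. Every number is a program, and \<open>while\<close> tests the first component of the memory.
\<close>

definition step :: "nat \<Rightarrow> nat" where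
  "step s = (let k = p1 s; v = p2 s; t = p1 (p1 (k - 1)); a = p2 (p1 (k - 1)); k' = p2 (k - 1) in
    if k = 0 then s
    else if t = 0 then pr k' (basic_op a v)
    else if t = 1 then pr (push (p1 a) (push (p2 a) k')) v
    else if p1 v = 0 then pr k' v
    else pr (push a k) v)"

lemma computable_step [computable_intros]:
  assumes "computable k a"
  shows "computable k (\<lambda>xs. step (a xs))"
proof (rule computable_comp1[OF _ assms])
  have "computable 2 (\<lambda>xs. basic_op (xs ! 0) (xs ! 1))"
    unfolding basic_op_def Let_def by (intro computable_intros) auto
  note computable_comp2[OF this, computable_intros]
  show "computable 1 (\<lambda>xs. step (xs ! 0))"
    unfolding step_def Let_def push_def by (intro computable_intros) auto
qed

text \<open>Running a given number of steps is total recursive; halting is an existential quantifier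
  over this number, hence its \<Sigma>01 form.\<close>

lemma computable_funpow_step [computable_intros]:
  assumes "computable k a" "computable k b"
  shows "computable k (\<lambda>xs. (step ^^ a xs) (b xs))"
proof -
  have "rec_nat s (\<lambda>_. step) n = (step ^^ n) s" for s n by (induction n) auto
  moreover have "computable 2 (\<lambda>xs. rec_nat (xs ! 1) (\<lambda>_ r. step r) (xs ! 0))"
    by (intro computable_intros) auto
  ultimately show ?thesis by (auto intro: computable_comp2 assms)
qed

lemma step_simps [simp]:
  "step (pr 0 v) = pr 0 v"
  "step (pr (push (opc a) k) v) = pr k (basic_op a v)"
  "step (pr (push (seq c d) k) v) = pr (push c (push d k)) v"
  "step (pr (push (while c) k) v) = (if p1 v = 0 then pr k v else pr (push c (push (while c) k)) v)"
  by (simp_all add: step_def push_def opc_def seq_def while_def)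

lemma push_neq_0 [simp]: "push c k \<noteq> 0"
  by (simp add: push_def)

section \<open>Reachability and halting\<close>

definition reaches :: "nat \<Rightarrow> nat \<Rightarrow> bool" where
  "reaches s s' \<longleftrightarrow> (\<exists>n. (step ^^ n) s = s')"

definition halts :: "nat \<Rightarrow> bool" where
  "halts s \<longleftrightarrow> (\<exists>n. p1 ((step ^^ n) s) = 0)"

lemma reaches_refl [simp]: "reaches s s"
  unfolding reaches_def by (intro exI[of _ 0]) simp

lemma reaches_step: "reaches (step s) s' \<Longrightarrow> reaches s s'"
  unfolding reaches_def by (metis funpow_swap1 funpow.simps(2) comp_apply)

lemma reaches_trans: "reaches s s' \<Longrightarrow> reaches s' s'' \<Longrightarrow> reaches s s''"
  unfolding reaches_def by (metis funpow_add comp_apply)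

lemma funpow_step_halted: "p1 s = 0 \<Longrightarrow> (step ^^ n) s = s"
  by (induction n) (auto simp: step_def)

lemma halts_at_later:
  assumes "p1 ((step ^^ m) s) = 0" "m \<le> n"
  shows "p1 ((step ^^ n) s) = 0"
proof -
  have "(step ^^ n) s = (step ^^ (n - m)) ((step ^^ m) s)"
    using assms(2) by (metis funpow_add comp_apply le_add_diff_inverse2)
  then show ?thesis using assms(1) funpow_step_halted by metis
qed

lemma halts_reaches:
  assumes "reaches s s'"
  shows "halts s \<longleftrightarrow> halts s'"
proof
  from assms obtain m where m: "(step ^^ m) s = s'" unfolding reaches_def by blast
  show "halts s" if "halts s'"
    using that m unfolding halts_def by (metis funpow_add comp_apply)
  assume "halts s"
  then obtain n where "p1 ((step ^^ n) s) = 0" unfolding halts_def by blast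
  \<comment> \<open>The halting time \<open>n\<close> may precede the arrival at \<open>s'\<close>,
    so it is delayed by \<open>m\<close>; halted configurations do not change.\<close>
  then have "p1 ((step ^^ (n + m)) s) = 0" by (rule halts_at_later) simp
  then have "p1 ((step ^^ n) s') = 0" using m by (simp add: funpow_add)
  then show "halts s'" unfolding halts_def by blast
qed

lemma halts_step: "halts (step s) \<longleftrightarrow> halts s"
  using halts_reaches[OF reaches_step[OF reaches_refl]] by blast

text \<open>The \<open>step\<close> in the second assumption forces at least one step per link, so
  any number of steps is exhausted by following the chain; halting between two links would persist
  to the next one.\<close>

lemma not_halts_chain:
  assumes "\<And>i. p1 (C i) \<noteq> 0" and "\<And>i. reaches (step (C i)) (C (Suc i))"
  shows "\<not> halts (C i)"
proof -
  have "p1 ((step ^^ n) (C i)) \<noteq> 0" for n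
  proof (induction n arbitrary: i rule: less_induct)
    case (less n)
    obtain m where m: "(step ^^ m) (step (C i)) = C (Suc i)"
      using assms(2) unfolding reaches_def by blast
    then have m': "(step ^^ Suc m) (C i) = C (Suc i)"
      by (simp add: funpow_swap1)
    show ?case
    proof (cases "n \<le> Suc m")
      case True
      then show ?thesis using halts_at_later m' assms(1) by metis
    next
      case False
      then have "(step ^^ n) (C i) = (step ^^ (n - Suc m)) (C (Suc i))"
        using m' by (metis funpow_add comp_apply le_add_diff_inverse2 nat_le_linear)
      then show ?thesis using less False by simp
    qed
  qed
  then show ?thesis unfolding halts_def by blast
qed

text \<open>Quantifying over the remaining stack \<open>k\<close> lets specifications of program
  fragments be chained. Both \<open>v\<close> and the result are whole memories.\<close>

definition computes :: "nat \<Rightarrow> nat \<Rightarrow> nat option \<Rightarrow> bool" where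
  "computes c v R \<longleftrightarrow> (\<forall>k. case R of
      Some u \<Rightarrow> reaches (pr (push c k) v) (pr k u)
    | None \<Rightarrow> \<not> halts (pr (push c k) v))"

lemma computes_opc: "basic_op a v = u \<Longrightarrow> computes (opc a) v (Some u)"
  unfolding computes_def by (auto intro: reaches_step)

text \<open>Common source of the rules for \<open>seq\<close> and for one round of a loop: both push
  a program \<open>c\<close> above a rest \<open>d\<close>, which for a loop is the loop
  itself.\<close>

lemma computes_step:
  assumes s: "\<And>k. step (pr (push e k) v) = pr (push c (push d k)) v"
    and c: "computes c v R" and d: "\<And>u. R = Some u \<Longrightarrow> computes d u R'"
    and none: "R = None \<Longrightarrow> R' = None"
  shows "computes e v R'"
proof (cases R)
  case None
  then show ?thesis
    using c none halts_step[of "pr (push e _) v"] unfolding computes_def s by simp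
next
  case (Some u)
  have e: "reaches (pr (push e k) v) (pr (push d k) u)" for k
    using c Some unfolding computes_def by (auto intro: reaches_step simp: s)
  show ?thesis
  proof (cases R')
    case None
    then show ?thesis
      using d[OF Some] halts_reaches[OF e] unfolding computes_def by simp
  next
    case (Some w)
    then show ?thesis
      using d[OF \<open>R = Some u\<close>] reaches_trans[OF e] unfolding computes_def by simp
  qed
qed

lemma computes_seq:
  assumes "computes c v R" "\<And>u. R = Some u \<Longrightarrow> computes d u R'" "R = None \<Longrightarrow> R' = None"
  shows "computes (seq c d) v R'"
  by (rule computes_step[OF _ assms]) simp_all

lemma computes_seq_opc: "computes d (basic_op a v) R \<Longrightarrow> computes (seq (opc a) d) v R"
  by (rule computes_seq[OF computes_opc[OF refl]]) auto

lemma computes_while_0: "p1 v = 0 \<Longrightarrow> computes (while c) v (Some v)"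
  unfolding computes_def by (auto intro: reaches_step)

lemma computes_while:
  assumes "p1 v \<noteq> 0" "computes c v R" "\<And>u. R = Some u \<Longrightarrow> computes (while c) u R'"
    "R = None \<Longrightarrow> R' = None"
  shows "computes (while c) v R'"
  by (rule computes_step[OF _ assms(2-4)]) (use assms(1) in simp_all)

lemma computes_while_forever:
  assumes "\<And>i. p1 (u i) \<noteq> 0" and "\<And>i. computes c (u i) (Some (u (Suc i)))"
  shows "computes (while c) (u 0) None"
proof -
  have "\<not> halts (pr (push (while c) k) (u i))" for k i
  proof (rule not_halts_chain[of "\<lambda>i. pr (push (while c) k) (u i)"])
    show "reaches (step (pr (push (while c) k) (u i))) (pr (push (while c) k) (u (Suc i)))" for i
      using assms(1)[of i] assms(2)[of i] unfolding computes_def by simp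
  qed simp
  then show ?thesis unfolding computes_def by simp
qed

section \<open>Compilation of recursive functions\<close>

text \<open>The length is not recorded: \<open>pr 0 0 = 0\<close>, so \<open>[]\<close> and
  \<open>[0]\<close> share a code. The arity of the compiled term supplies it.\<close>

fun list_code :: "nat list \<Rightarrow> nat" where
  "list_code [] = 0"
| "list_code (x # xs) = pr x (list_code xs)"

fun compile_proj :: "nat \<Rightarrow> nat" where
  "compile_proj 0 = opc 2"
| "compile_proj (Suc i) = seq (opc 3) (compile_proj i)"

text \<open>The argument list is duplicated before each evaluation, and the swap brings the copy
  back above the value just found. With no terms left, the last copy becomes the empty list of
  values.\<close>

fun compile_args :: "nat list \<Rightarrow> nat" where
  "compile_args [] = opc 0"
| "compile_args (c # cs) = seq (opc 4) (seq c (seq (opc 5) (seq (compile_args cs) (opc 6))))"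

text \<open>
  The memory is used as a stack: compiled code replaces the argument list \<open>t\<close> on top of \<open>pr t r\<close> by
  the value and leaves \<open>r\<close> alone. The loop of \<open>PrimRec\<close> keeps \<open>pr m (pr (pr i (pr y xs)) r)\<close> with \<open>m\<close>
  remaining iterations, counter \<open>i\<close> and current value \<open>y\<close>; the loop of \<open>Mu\<close> keeps
  \<open>pr t (pr (pr z xs) r)\<close>, where \<open>z\<close> is the next candidate and \<open>t\<close> the value at the previous one.
\<close>

fun compile :: "recf \<Rightarrow> nat" where
  "compile Zero = opc 0"
| "compile Succ = opc 1"
| "compile (Proj i) = compile_proj i"
| "compile (Comp f gs) = seq (compile_args (map compile gs)) (compile f)"
| "compile (PrimRec f g) =
    seq (opc 4) (seq (opc 3) (seq (compile f) (seq (opc 7)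
      (seq (while (seq (opc 8) (seq (compile g) (opc 9)))) (opc 10)))))"
| "compile (Mu f) = seq (opc 11) (seq (while (seq (opc 12) (compile f))) (opc 13))"

lemma computes_compile_proj:
  "i < length xs \<Longrightarrow> computes (compile_proj i) (pr (list_code xs) r) (Some (pr (xs ! i) r))"
proof (induction i arbitrary: xs)
  case 0
  then obtain x ys where "xs = x # ys" by (cases xs) auto
  then show ?case by (auto intro!: computes_opc simp: basic_op_def Let_def)
next
  case (Suc i)
  then obtain x ys where "xs = x # ys" by (cases xs) auto
  with Suc show ?case by (auto intro!: computes_seq_opc simp: basic_op_def Let_def)
qed

lemma computes_compile_args:
  assumes "\<And>g r. g \<in> set gs \<Longrightarrow>
    computes (compile g) (pr (list_code xs) r) (map_option (\<lambda>y. pr y r) (eval g xs))"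
  shows "computes (compile_args (map compile gs)) (pr (list_code xs) r)
    (if \<forall>g\<in>set gs. eval g xs \<noteq> None
     then Some (pr (list_code (map (\<lambda>g. the (eval g xs)) gs)) r) else None)"
  using assms
proof (induction gs arbitrary: r)
  case Nil
  show ?case by (auto intro!: computes_opc simp: basic_op_def Let_def)
next
  case (Cons g gs)
  let ?xs = "list_code xs"
  have g: "computes (compile g) (pr ?xs r) (map_option (\<lambda>y. pr y r) (eval g xs))" for r
    by (rule Cons.prems) simp
  have gs: "computes (compile_args (map compile gs)) (pr ?xs r)
    (if \<forall>g\<in>set gs. eval g xs \<noteq> None
     then Some (pr (list_code (map (\<lambda>g. the (eval g xs)) gs)) r) else None)" for r
    by (rule Cons.IH, rule Cons.prems) simp
  have fin: "computes (opc 6) (pr ys (pr y r)) (Some (pr (pr y ys) r))" for y ys r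
    by (auto intro!: computes_opc simp: basic_op_def Let_def)
  show ?case
  proof (cases "\<forall>g\<in>set gs. eval g xs \<noteq> None")
    case True
    then show ?thesis
      by (auto simp: basic_op_def Let_def
          intro!: computes_seq_opc computes_seq[OF g] computes_seq[OF gs] fin)
  next
    case False
    have gs: "computes (compile_args (map compile gs)) (pr ?xs r) None"
      if "\<not> (\<forall>g\<in>set gs. eval g xs \<noteq> None)" for r
      using gs[of r] unfolding if_not_P[OF that] .
    from False show ?thesis
      by (auto simp: basic_op_def Let_def
          intro!: computes_seq_opc computes_seq[OF g] computes_seq[OF gs])
  qed
qed

lemma computes_compile_primrec:
  assumes f: "\<And>r. computes (compile f) (pr (list_code xs) r)
      (map_option (\<lambda>y. pr y r) (eval f xs))"
    and g: "\<And>i y r. computes (compile g) (pr (list_code (i # y # xs)) r)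
      (map_option (\<lambda>y. pr y r) (eval g (i # y # xs)))"
  shows "computes (compile (PrimRec f g)) (pr (list_code (n # xs)) r)
    (map_option (\<lambda>y. pr y r) (eval (PrimRec f g) (n # xs)))"
proof -
  define val where "val = rec_nat (eval f xs) (\<lambda>y r. Option.bind r (\<lambda>v. eval g (y # v # xs)))"
  define loop where "loop = while (seq (opc 8) (seq (compile g) (opc 9)))"
  define V where "V m i y = pr m (pr (pr i (pr y (list_code xs))) r)" for m i y
  have val_None: "val (i + m) = None" if "val i = None" for i m
    using that by (induction m) (auto simp: val_def)
  have op9: "computes (opc 9) (pr y' (pr m (pr (pr i (list_code xs)) r))) (Some (V m i y'))"
    for y' m i
    by (auto intro!: computes_opc simp: basic_op_def Let_def V_def)
  have body: "computes (seq (opc 8) (seq (compile g) (opc 9))) (V (Suc m) i y)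
    (map_option (V m (Suc i)) (eval g (i # y # xs)))" for m i y
    by (cases "eval g (i # y # xs)")
      (auto simp: basic_op_def Let_def V_def[of "Suc m"]
        intro!: computes_seq_opc computes_seq[OF g[simplified]] op9)
  \<comment> \<open>Loop invariant: \<open>y\<close> is the value at \<open>i\<close>, and counter
    plus remaining iterations stays constant. A divergent value propagates by
    \<open>val_None\<close>.\<close>
  have loop: "computes loop (V m i y) (map_option (V 0 (i + m)) (val (i + m)))"
    if "val i = Some y" for m i y
    using that
  proof (induction m arbitrary: i y)
    case 0
    then show ?case unfolding loop_def by (auto simp: V_def intro: computes_while_0)
  next
    case (Suc m)
    have next_val: "val (Suc i) = eval g (i # y # xs)"
      using Suc.prems by (simp add: val_def)
    show ?case
      unfolding loop_def
    proof (rule computes_while[OF _ body])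
      show "p1 (V (Suc m) i y) \<noteq> 0" by (simp add: V_def)
      show "computes (while (seq (opc 8) (seq (compile g) (opc 9)))) u
          (map_option (V 0 (i + Suc m)) (val (i + Suc m)))"
        if "map_option (V m (Suc i)) (eval g (i # y # xs)) = Some u" for u
        using that Suc.IH[of "Suc i"] next_val unfolding loop_def by auto
      show "map_option (V 0 (i + Suc m)) (val (i + Suc m)) = None"
        if "map_option (V m (Suc i)) (eval g (i # y # xs)) = None"
        using that val_None[of "Suc i" m] next_val by simp
    qed
  qed
  have op10: "computes (opc 10) (V m i y) (Some (pr y r))" for m i y
    by (auto intro!: computes_opc simp: basic_op_def Let_def V_def)
  have tail: "computes (seq loop (opc 10)) (pr n (pr (pr 0 (pr y (list_code xs))) r))
      (map_option (\<lambda>y. pr y r) (val n))"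
    if "eval f xs = Some y" for y
  proof -
    have "computes loop (V n 0 y) (map_option (V 0 n) (val n))"
      using loop[of 0 y n] that by (simp add: val_def)
    then have "computes (seq loop (opc 10)) (V n 0 y) (map_option (\<lambda>y. pr y r) (val n))"
      by (rule computes_seq) (auto intro: op10)
    then show ?thesis
      by (simp add: V_def)
  qed
  have "eval (PrimRec f g) (n # xs) = val n" by (simp add: val_def)
  moreover have "val n = None" if "eval f xs = None"
    using val_None[of 0 n] that by (simp add: val_def)
  ultimately show ?thesis
    unfolding compile.simps loop_def[symmetric]
    by (auto simp: basic_op_def Let_def simp del: eval.simps
        intro!: computes_seq_opc computes_seq[OF f] tail)
qed

lemma computes_compile_mu:
  assumes f: "\<And>z r. computes (compile f) (pr (list_code (z # xs)) r)
      (map_option (\<lambda>y. pr y r) (eval f (z # xs)))"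
  shows "computes (compile (Mu f)) (pr (list_code xs) r)
    (map_option (\<lambda>y. pr y r) (eval (Mu f) xs))"
proof -
  define h where "h z = eval f (z # xs)" for z
  define U where "U z t = pr t (pr (pr z (list_code xs)) r)" for z t
  define body where "body = seq (opc 12) (compile f)"
  have body: "computes body (U z t) (map_option (U (Suc z)) (h z))" for z t
    using f[of z "pr (pr (Suc z) (list_code xs)) r"]
    unfolding body_def by (intro computes_seq_opc) (simp add: basic_op_def Let_def U_def [abs_def] h_def)
  \<comment> \<open>The initial 1 is a dummy nonzero value that lets the loop start. At exit the
    candidate has already advanced, hence \<open>Suc z\<close>, which instruction 13
    corrects.\<close>
  have while: "computes (while body) (U 0 1)
    (map_option (\<lambda>z. U (Suc z) 0) (eval (Mu f) xs))"
  \<comment> \<open>The search stops being regular at the first zero or divergence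
    \<open>z1\<close>, whichever comes first; otherwise it passes through infinitely many nonzero
    values.\<close>
  proof (cases "\<exists>z. h z = None \<or> h z = Some 0")
    case True
    define z1 where "z1 = (LEAST z. h z = None \<or> h z = Some 0)"
    have z1: "h z1 = None \<or> h z1 = Some 0"
      unfolding z1_def using True by (rule LeastI_ex)
    have below: "h z \<noteq> None" "h z \<noteq> Some 0" if "z < z1" for z
      using not_less_Least[OF that[unfolded z1_def]] by auto
    have loop: "computes (while body) (U z t) (map_option (U (Suc z1)) (h z1))"
      if "z \<le> z1" "t \<noteq> 0" for z t
      using that
    proof (induction z arbitrary: t rule: inc_induct)
      case base
      then show ?case
        using z1 by (intro computes_while[OF _ body]) (auto simp: U_def intro!: computes_while_0)
    next
      case (step z)
      then show ?case
        using below[of z] by (intro computes_while[OF _ body]) (auto simp: U_def[of z])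
    qed
    have "map_option (\<lambda>z. U (Suc z) 0) (eval (Mu f) xs) = map_option (U (Suc z1)) (h z1)"
    proof (cases "h z1")
      case None
      \<comment> \<open>A zero could only lie above \<open>z1\<close>, where the divergence at
        \<open>z1\<close> blocks it.\<close>
      then have "\<not> (\<exists>z. h z = Some 0 \<and> (\<forall>y<z. h y \<noteq> None))"
        using below by (metis linorder_neqE_nat option.distinct(1))
      with None show ?thesis by (auto simp: h_def)
    next
      case (Some a)
      with z1 have zero: "h z1 = Some 0" by simp
      then have "(LEAST z. h z = Some 0) = z1"
        using below by (intro Least_equality) (auto simp: not_less[symmetric])
      then show ?thesis using zero below by (auto simp: h_def)
    qed
    then show ?thesis using loop[of 0 1] by simp
  next
    case False
    define u where "u i = U i (case i of 0 \<Rightarrow> 1 | Suc j \<Rightarrow> the (h j))" for i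
    have h: "h i = Some (the (h i))" "the (h i) \<noteq> 0" for i
      using False by (metis option.collapse)+
    have "computes (while body) (u 0) None"
    proof (rule computes_while_forever)
      show "p1 (u i) \<noteq> 0" for i
        using h(2) by (cases i) (auto simp: u_def U_def)
      show "computes body (u i) (Some (u (Suc i)))" for i
        using body[of i] h(1)[of i] unfolding u_def by (metis option.simps(9) nat.case(2))
    qed
    moreover have "eval (Mu f) xs = None"
      using False by (auto simp: h_def)
    ultimately show ?thesis by (simp add: u_def)
  qed
  have op13: "computes (opc 13) (U (Suc z) t) (Some (pr z r))" for z t
    by (auto intro!: computes_opc simp: basic_op_def Let_def U_def)
  have "computes (seq (while body) (opc 13)) (U 0 1) (map_option (\<lambda>y. pr y r) (eval (Mu f) xs))"
    by (rule computes_seq[OF while]) (auto intro: op13 simp del: eval.simps)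
  then show ?thesis
    unfolding compile.simps body_def[symmetric]
    by (intro computes_seq_opc) (simp add: basic_op_def Let_def U_def del: eval.simps)
qed

theorem computes_compile:
  "has_arity f (length xs) \<Longrightarrow>
    computes (compile f) (pr (list_code xs) r) (map_option (\<lambda>y. pr y r) (eval f xs))"
proof (induction f arbitrary: xs r)
  case Zero
  show ?case by (auto intro!: computes_opc simp: basic_op_def Let_def)
next
  case Succ
  then obtain x where "xs = [x]" by (cases xs) auto
  then show ?case by (auto intro!: computes_opc simp: basic_op_def Let_def)
next
  case (Proj i)
  then show ?case by (simp add: computes_compile_proj)
next
  case (Comp f gs)
  have "computes (compile_args (map compile gs)) (pr (list_code xs) r)
    (if \<forall>g\<in>set gs. eval g xs \<noteq> None
     then Some (pr (list_code (map (\<lambda>g. the (eval g xs)) gs)) r) else None)"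
    using Comp by (intro computes_compile_args) auto
  then show ?case
    unfolding compile.simps
    by (rule computes_seq) (use Comp in \<open>auto split: if_splits\<close>)
next
  case (PrimRec f g)
  then obtain n ys where xs: "xs = n # ys" by (cases xs) auto
  show ?case
    unfolding xs by (rule computes_compile_primrec; rule PrimRec.IH) (use PrimRec.prems xs in simp_all)
next
  case (Mu f)
  show ?case
    by (rule computes_compile_mu, rule Mu.IH) (use Mu.prems in simp)
qed

text \<open>The memory is \<open>list_code [p, w]\<close> above an empty rest.\<close>

definition start :: "nat \<Rightarrow> nat \<Rightarrow> nat \<Rightarrow> nat" where
  "start e p w = pr (push e 0) (pr (pr p (pr w 0)) 0)"

corollary halts_compile:
  assumes "has_arity f 2"
  shows "halts (start (compile f) p w) \<longleftrightarrow> eval f [p, w] \<noteq> None"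
proof -
  have "computes (compile f) (pr (pr p (pr w 0)) 0) (map_option (\<lambda>y. pr y 0) (eval f [p, w]))"
    using computes_compile[of f "[p, w]" 0] assms by (simp add: numeral_2_eq_2)
  moreover have "halts (pr 0 v)" for v
    unfolding halts_def by (intro exI[of _ 0]) simp
  ultimately show ?thesis
    unfolding computes_def start_def using halts_reaches
    by (cases "eval f [p, w]") (simp_all, blast)
qed

section \<open>The construction\<close>

text \<open>Each bijective digit is one more than the bit, so the code is the binary value of the
  low \<open>m\<close> bits plus the sum of the powers of two below \<open>2 ^ m\<close>.\<close>

lemma word_code_set_decode:
  "word_code (map (\<lambda>i. i \<in> set_decode g) [0..<m]) = 2 ^ m - 1 + g mod 2 ^ m"
proof (induction m arbitrary: g)
  case 0
  show ?case by simp
next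
  case (Suc m)
  have "map (\<lambda>i. i \<in> set_decode g) [0..<Suc m] =
      odd g # map (\<lambda>i. i \<in> set_decode (g div 2)) [0..<m]"
    unfolding upt_conv_Cons[OF zero_less_Suc] map_Suc_upt[symmetric] by simp
  then have "word_code (map (\<lambda>i. i \<in> set_decode g) [0..<Suc m]) =
      2 * (2 ^ m - 1 + g div 2 mod 2 ^ m) + Suc (g mod 2)"
    using Suc by (simp add: odd_iff_mod_2_eq_one)
  moreover have "g mod 2 ^ Suc m = 2 * (g div 2 mod 2 ^ m) + g mod 2"
    by (simp add: mod_mult2_eq)
  moreover have "2 * (a - 1 + b) + Suc c = 2 * a - 1 + (2 * b + c)" if "1 \<le> a" for a b c :: nat
    using that by simp
  ultimately show ?case by simp
qed

lemma set_encode_less: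
  assumes "A \<subseteq> {..<n}"
  shows "set_encode A < 2 ^ n"
proof -
  have "set_encode A \<le> sum ((^) 2) {..<n}"
    unfolding set_encode_def using assms by (intro sum_mono2) auto
  also have "\<dots> < 2 ^ n"
    by (induction n) auto
  finally show ?thesis .
qed

text \<open>One witness packs both the preimage and the stage.\<close>

lemma Sigma01_image:
  assumes P: "computable 2 (\<lambda>xs. of_bool (P (xs ! 0) (xs ! 1)))"
    and f: "computable 1 (\<lambda>xs. f (xs ! 0))"
  shows "Sigma01 {f p |p. \<exists>n. P p n}"
proof -
  define R where "R x y \<longleftrightarrow> x = f (p1 y) \<and> P (p1 y) (p2 y)" for x y
  have "computable 2 (\<lambda>xs. of_bool (R (xs ! 0) (xs ! 1)))"
    unfolding R_def
    by (intro computable_conj computable_eq computable_comp1[OF f]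
        computable_comp2[OF P] computable_intros) auto
  moreover have "{f p |p. \<exists>n. P p n} = {x. \<exists>y. R x y}"
  proof (intro Collect_cong iffI)
    fix x
    assume "\<exists>p. x = f p \<and> (\<exists>n. P p n)"
    then obtain p n where "x = f p" "P p n" by blast
    then have "R x (pr p n)" by (simp add: R_def)
    then show "\<exists>y. R x y" ..
  qed (auto simp: R_def)
  ultimately show ?thesis
    unfolding Sigma01_def recursive_relation_def computable_def by blast
qed

section \<open>Levels, places and the diagonal set\<close>

text \<open>
  Level \<open>n\<close> consists of the positions \<open>pr n g\<close> with \<open>g < 2 ^ floor_of \<phi> n\<close>. All places of earlier
  levels are below \<open>floor_of \<phi> n\<close>, and those of level \<open>n\<close> start at \<open>base \<phi> n\<close>.
\<close>

definition level_sum :: "(nat \<Rightarrow> nat) \<Rightarrow> nat \<Rightarrow> nat \<Rightarrow> nat" where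
  "level_sum \<phi> n l = rec_nat 0 (\<lambda>g r. r + \<phi> (pr n g)) (2 ^ l)"

text \<open>The summands are the start of the gap, its length, and the number of places of the
  level.\<close>

definition floor_of :: "(nat \<Rightarrow> nat) \<Rightarrow> nat \<Rightarrow> nat" where
  "floor_of \<phi> = rec_nat 0 (\<lambda>n l. l + level_sum \<phi> n l + 2 ^ l)"

definition base :: "(nat \<Rightarrow> nat) \<Rightarrow> nat \<Rightarrow> nat" where
  "base \<phi> n = floor_of \<phi> n + level_sum \<phi> n (floor_of \<phi> n)"

text \<open>The sum over the level serves as a computable substitute for the maximum of
  \<open>\<phi>\<close> there.\<close>

lemma level_sum_ge: "g < 2 ^ l \<Longrightarrow> \<phi> (pr n g) \<le> level_sum \<phi> n l"
proof -
  have "\<phi> (pr n g) \<le> rec_nat 0 (\<lambda>g r. r + \<phi> (pr n g)) m" if "g < m" for m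
    using that
  proof (induction m)
    case (Suc m)
    then show ?case by (cases "g = m") auto
  qed simp
  then show "g < 2 ^ l \<Longrightarrow> ?thesis" by (simp add: level_sum_def)
qed

lemma floor_of_Suc: "floor_of \<phi> (Suc n) = base \<phi> n + 2 ^ floor_of \<phi> n"
  by (simp add: floor_of_def base_def)

lemma floor_of_le_base: "floor_of \<phi> n \<le> base \<phi> n"
  by (simp add: base_def)

lemma floor_of_Suc_le:
  assumes "m < n"
  shows "floor_of \<phi> (Suc m) \<le> floor_of \<phi> n"
proof (rule lift_Suc_mono_le[of "floor_of \<phi>"])
  show "floor_of \<phi> n \<le> floor_of \<phi> (Suc n)" for n
    using floor_of_le_base[of \<phi> n] by (simp add: floor_of_Suc)
qed (use assms in simp)

text \<open>For large \<open>p2 p\<close> the value may run into later levels;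
  \<open>diagonal\<close> admits only positions within their level.\<close>

definition place :: "(nat \<Rightarrow> nat) \<Rightarrow> nat \<Rightarrow> nat" where
  "place \<phi> p = base \<phi> (p1 p) + p2 p"

text \<open>By \<open>word_code_set_decode\<close>, the code of the first \<open>\<phi> p\<close>
  bits of the set encoded by \<open>p2 p\<close>; it does not refer to the set under
  construction.\<close>

definition guess :: "(nat \<Rightarrow> nat) \<Rightarrow> nat \<Rightarrow> nat" where
  "guess \<phi> p = 2 ^ \<phi> p - 1 + p2 p mod 2 ^ \<phi> p"

text \<open>
  The position \<open>p = pr n g\<close> works for the program \<open>p1 n\<close> under the assumption that \<open>g\<close> encodes
  the part of the set below \<open>floor_of \<phi> n\<close>.
\<close>

definition diagonal :: "(nat \<Rightarrow> nat) \<Rightarrow> nat set" where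
  "diagonal \<phi> = {place \<phi> p |p. p2 p < 2 ^ floor_of \<phi> (p1 p) \<and> halts (start (p1 (p1 p)) p (guess \<phi> p))}"

lemma place_less: "p2 p < 2 ^ floor_of \<phi> (p1 p) \<Longrightarrow> place \<phi> p < floor_of \<phi> (Suc (p1 p))"
  by (simp add: place_def floor_of_Suc)

lemma floor_of_le_place: "floor_of \<phi> (p1 p) \<le> place \<phi> p"
  using floor_of_le_base[of \<phi> "p1 p"] by (simp add: place_def)

lemma place_eqD:
  assumes "place \<phi> p = place \<phi> q"
    and "p2 p < 2 ^ floor_of \<phi> (p1 p)" "p2 q < 2 ^ floor_of \<phi> (p1 q)"
  shows "p = q"
proof -
  have "place \<phi> p < place \<phi> q" if "p2 p < 2 ^ floor_of \<phi> (p1 p)" "p1 p < p1 q" for p q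
    using place_less[OF that(1)] floor_of_Suc_le[OF that(2), of \<phi>] floor_of_le_place[of \<phi> q]
    by linarith
  then have "p1 p = p1 q"
    using assms by (metis linorder_neqE_nat less_irrefl)
  moreover from this have "p2 p = p2 q"
    using assms(1) by (simp add: place_def)
  ultimately have "prod_decode p = prod_decode q"
    by (rule prod_eqI)
  then show ?thesis
    by simp
qed

text \<open>Earlier levels end below \<open>floor_of \<phi> n\<close> and all others start at or
  above \<open>base \<phi> n\<close>, so the set has a gap in between.\<close>

lemma diagonal_below_base:
  assumes "x \<in> diagonal \<phi>" "x < base \<phi> n"
  shows "x < floor_of \<phi> n"
proof -
  from assms(1) obtain p where p: "x = place \<phi> p" "p2 p < 2 ^ floor_of \<phi> (p1 p)"
    unfolding diagonal_def by blast
  have "p1 p < n"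
  proof (rule ccontr)
    assume "\<not> p1 p < n"
    then have "base \<phi> n \<le> base \<phi> (p1 p)"
      using floor_of_Suc_le[of n "p1 p" \<phi>] floor_of_le_base[of \<phi> "p1 p"]
      by (cases "n = p1 p") (auto simp: floor_of_Suc)
    with p(1) assms(2) show False by (simp add: place_def)
  qed
  then show ?thesis
    using place_less[OF p(2)] floor_of_Suc_le[of "p1 p" n \<phi>] p(1) by linarith
qed

lemma guess_correct:
  assumes g: "g = set_encode (diagonal \<phi> \<inter> {..<floor_of \<phi> n})"
  shows "word_code (restrict_word (diagonal \<phi>) (\<phi> (pr n g))) = guess \<phi> (pr n g)"
proof -
  have "g < 2 ^ floor_of \<phi> n"
    unfolding g by (rule set_encode_less) simp
  \<comment> \<open>\<open>base\<close> bounds \<open>\<phi>\<close> at all candidates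
    \<open>g\<close> of the level, so the correct \<open>g\<close> need not be known when the gap is
    chosen.\<close>
  then have le: "\<phi> (pr n g) \<le> base \<phi> n"
    using level_sum_ge[of g "floor_of \<phi> n" \<phi> n] by (simp add: base_def)
  have "i \<in> diagonal \<phi> \<longleftrightarrow> i \<in> set_decode g" if "i < \<phi> (pr n g)" for i
    using diagonal_below_base[of i \<phi> n] that le unfolding g by auto
  then have "restrict_word (diagonal \<phi>) (\<phi> (pr n g)) =
      map (\<lambda>i. i \<in> set_decode g) [0..<\<phi> (pr n g)]"
    unfolding restrict_word_def by simp
  then show ?thesis
    by (simp add: word_code_set_decode guess_def)
qed

lemma place_in_diagonal_iff:
  assumes "p2 p < 2 ^ floor_of \<phi> (p1 p)"
  shows "place \<phi> p \<in> diagonal \<phi> \<longleftrightarrow> halts (start (p1 (p1 p)) p (guess \<phi> p))"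
proof
  assume "place \<phi> p \<in> diagonal \<phi>"
  then obtain q where q: "place \<phi> q = place \<phi> p" "p2 q < 2 ^ floor_of \<phi> (p1 q)"
    "halts (start (p1 (p1 q)) q (guess \<phi> q))"
    unfolding diagonal_def by auto
  from q(1,2) assms have "q = p" by (rule place_eqD)
  with q(3) show "halts (start (p1 (p1 p)) p (guess \<phi> p))" by simp
qed (use assms in \<open>auto simp: diagonal_def\<close>)

section \<open>Effectiveness and impredictability\<close>

context
  fixes \<phi> :: "nat \<Rightarrow> nat"
  assumes total: "total_recursive \<phi>"
begin

lemma computable_total: "computable k a \<Longrightarrow> computable k (\<lambda>xs. \<phi> (a xs))"
  by (rule computable_comp1) (use total in \<open>simp add: total_recursive_def computable_def\<close>)

lemma computable_level_sum:
  assumes "computable k a" "computable k b"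
  shows "computable k (\<lambda>xs. level_sum \<phi> (a xs) (b xs))"
proof (rule computable_comp2[OF _ assms])
  show "computable 2 (\<lambda>xs. level_sum \<phi> (xs ! 0) (xs ! 1))"
    unfolding level_sum_def by (intro computable_intros computable_total) auto
qed

lemma computable_floor_of: "computable k a \<Longrightarrow> computable k (\<lambda>xs. floor_of \<phi> (a xs))"
  unfolding floor_of_def by (intro computable_intros computable_level_sum) auto

lemma computable_base: "computable k a \<Longrightarrow> computable k (\<lambda>xs. base \<phi> (a xs))"
  unfolding base_def by (intro computable_intros computable_level_sum computable_floor_of)

lemma computable_place: "computable 1 (\<lambda>xs. place \<phi> (xs ! 0))"
  unfolding place_def by (intro computable_intros computable_base) auto

lemma Sigma01_diagonal: "Sigma01 (diagonal \<phi>)"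
proof -
  define P where "P p n \<longleftrightarrow> p2 p < 2 ^ floor_of \<phi> (p1 p) \<and>
    p1 ((step ^^ n) (start (p1 (p1 p)) p (guess \<phi> p))) = 0" for p n
  have "computable 2 (\<lambda>xs. of_bool (P (xs ! 0) (xs ! 1)))"
    unfolding P_def start_def push_def guess_def
    by (intro computable_intros computable_floor_of computable_total) auto
  then have "Sigma01 {place \<phi> p |p. \<exists>n. P p n}"
    using computable_place by (rule Sigma01_image)
  moreover have "{place \<phi> p |p. \<exists>n. P p n} = diagonal \<phi>"
    unfolding diagonal_def P_def halts_def by blast
  ultimately show ?thesis by simp
qed

lemma impredictable_diagonal: "impredictable \<phi> (diagonal \<phi>)"
  unfolding impredictable_def
proof (intro exI[of _ "place \<phi>"] conjI allI impI)
  show "total_recursive (place \<phi>)"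
    using computable_place by (simp add: total_recursive_def computable_def)
  fix \<chi>
  assume "partial_recursive_on_words \<chi>"
  then obtain f where f: "has_arity f 2" "\<And>p w. \<chi> p w = eval f [p, word_code w]"
    unfolding partial_recursive_on_words_def partial_recursive_def by auto
  \<comment> \<open>The index \<open>j\<close> is padding that gives the program infinitely many
    levels. The true \<open>g\<close> is chosen non-effectively, which suffices because such
    positions only have to exist.\<close>
  define pos where "pos j = (let n = pr (compile f) j in
    pr n (set_encode (diagonal \<phi> \<inter> {..<floor_of \<phi> n})))" for j
  have "place \<phi> (pos j) \<in> diagonal \<phi> \<longleftrightarrow>
      \<chi> (pos j) (restrict_word (diagonal \<phi>) (\<phi> (pos j))) \<noteq> None" for j
  proof -
    have "place \<phi> (pos j) \<in> diagonal \<phi> \<longleftrightarrow>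
        halts (start (p1 (p1 (pos j))) (pos j) (guess \<phi> (pos j)))"
      by (rule place_in_diagonal_iff) (simp add: pos_def Let_def set_encode_less)
    also have "p1 (p1 (pos j)) = compile f"
      by (simp add: pos_def Let_def)
    also have "guess \<phi> (pos j) = word_code (restrict_word (diagonal \<phi>) (\<phi> (pos j)))"
      by (simp add: pos_def Let_def guess_correct)
    finally show ?thesis by (simp only: halts_compile[OF f(1)] f(2))
  qed
  moreover have "inj pos"
    by (rule injI) (simp add: pos_def Let_def)
  then have "infinite (range pos)"
    by (simp add: finite_image_iff)
  ultimately show "infinite {p. place \<phi> p \<in> diagonal \<phi> \<longleftrightarrow>
      \<chi> p (restrict_word (diagonal \<phi>) (\<phi> p)) \<noteq> None}"
    by (elim infinite_super[rotated]) auto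
qed

end

theorem theorem2:
  fixes \<phi> :: "nat \<Rightarrow> nat"
  assumes "total_recursive \<phi>"
  shows "\<exists>A. Sigma01 A \<and> impredictable \<phi> A"
  using Sigma01_diagonal[OF assms] impredictable_diagonal[OF assms] by blast

end
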